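(* Let $\mathbf{y}\in\mathbb{Q}$ be given, and consider the problem of minimizing over $\mathbf{x}\in\mathbb{Q}$ the function $$g(\mathbf{x})=\tfrac12|\mathbf{x}-\mathbf{y}|^2+\nu|\mathbf{x}|^p .$$ For given $\nu>0$ and $p$ $(0<p<1)$, an optimal solution of this minimization problem is given by the quaternion generalized soft-thresholding (QGST) operator, which is defined by $$\mathrm{QGST}(\mathbf{y},\nu,p)=\begin{cases}0,&\text{if } |\mathbf{y}|\le \tau_p^{\mathrm{QGST}}(\nu),\\ \mathrm{signQ}(\mathbf{y})\,T_p^{\mathrm{QGST}}(|\mathbf{y}|,\nu),&\text{if } |\mathbf{y}|>\tau_p^{\mathrm{QGST}}(\nu),\end{cases}$$ where $$\tau_p^{\mathrm{QGST}}(\nu)=(2\nu(1-p))^{\frac{1}{2-p}}+\nu p\,(2\nu(1-p))^{\frac{p-1}{2-p}}$$ is a threshold value, and $T_p^{\mathrm{QGST}}(|\mathbf{y}|,\nu)$ can be obtained by solving the equation $$T_p^{\mathrm{QGST}}(|\mathbf{y}|,\nu)-|\mathbf{y}|+\nu p\,\big(T_p^{\mathrm{QGST}}(|\mathbf{y}|,\nu)\big)^{p-1}=0 .$$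
   Context: $\mathbb{Q}$ denotes the set of real quaternions $\mathbf{q}=q_0+q_1\mathbf{i}+q_2\mathbf{j}+q_3\mathbf{k}$ with $q_0,q_1,q_2,q_3\in\mathbb{R}$, with modulus $|\mathbf{q}|=\sqrt{q_0^2+q_1^2+q_2^2+q_3^2}$. For $\mathbf{q}\in\mathbb{Q}$, $\mathrm{signQ}(\mathbf{q})=\mathbf{q}/|\mathbf{q}|$ if $|\mathbf{q}|\ne 0$ and $\mathrm{signQ}(\mathbf{q})=0$ otherwise. *)

theory Defs
  imports "HOL-Analysis.Analysis"
begin

text \<open>\<open>Quat a b c d\<close> stands for the quaternion \<open>a + b i + c j + d k\<close>.\<close>

datatype quat = Quat (q_re: real) (q_i: real) (q_j: real) (q_k: real)

lemma quat_eq_iff: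
  "x = y \<longleftrightarrow> q_re x = q_re y \<and> q_i x = q_i y \<and> q_j x = q_j y \<and> q_k x = q_k y"
  by (cases x; cases y) simp

instantiation quat :: real_vector
begin

definition zero_quat :: quat where
  "0 = Quat 0 0 0 0"

definition plus_quat :: "quat \<Rightarrow> quat \<Rightarrow> quat" where
  "x + y = Quat (q_re x + q_re y) (q_i x + q_i y) (q_j x + q_j y) (q_k x + q_k y)"

definition uminus_quat :: "quat \<Rightarrow> quat" where
  "- x = Quat (- q_re x) (- q_i x) (- q_j x) (- q_k x)"

definition minus_quat :: "quat \<Rightarrow> quat \<Rightarrow> quat" where
  "x - y = Quat (q_re x - q_re y) (q_i x - q_i y) (q_j x - q_j y) (q_k x - q_k y)"

definition scaleR_quat :: "real \<Rightarrow> quat \<Rightarrow> quat" where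
  "r *\<^sub>R x = Quat (r * q_re x) (r * q_i x) (r * q_j x) (r * q_k x)"

instance
  by standard
    (simp_all add: zero_quat_def plus_quat_def uminus_quat_def minus_quat_def scaleR_quat_def
      algebra_simps)

end

lemma quat_zero_sel [simp]: "q_re 0 = 0" "q_i 0 = 0" "q_j 0 = 0" "q_k 0 = 0"
  by (simp_all add: zero_quat_def)

lemma quat_plus_sel [simp]:
  "q_re (x + y) = q_re x + q_re y" "q_i (x + y) = q_i x + q_i y"
  "q_j (x + y) = q_j x + q_j y" "q_k (x + y) = q_k x + q_k y"
  by (simp_all add: plus_quat_def)

lemma quat_uminus_sel [simp]:
  "q_re (- x) = - q_re x" "q_i (- x) = - q_i x" "q_j (- x) = - q_j x" "q_k (- x) = - q_k x"
  by (simp_all add: uminus_quat_def)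

lemma quat_minus_sel [simp]:
  "q_re (x - y) = q_re x - q_re y" "q_i (x - y) = q_i x - q_i y"
  "q_j (x - y) = q_j x - q_j y" "q_k (x - y) = q_k x - q_k y"
  by (simp_all add: minus_quat_def)

lemma quat_scaleR_sel [simp]:
  "q_re (r *\<^sub>R x) = r * q_re x" "q_i (r *\<^sub>R x) = r * q_i x"
  "q_j (r *\<^sub>R x) = r * q_j x" "q_k (r *\<^sub>R x) = r * q_k x"
  by (simp_all add: scaleR_quat_def)

instantiation quat :: real_algebra_1
begin

definition one_quat :: quat where
  "1 = Quat 1 0 0 0"

definition times_quat :: "quat \<Rightarrow> quat \<Rightarrow> quat" where
  "x * y = Quat
     (q_re x * q_re y - q_i x * q_i y - q_j x * q_j y - q_k x * q_k y)
     (q_re x * q_i y + q_i x * q_re y + q_j x * q_k y - q_k x * q_j y)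
     (q_re x * q_j y - q_i x * q_k y + q_j x * q_re y + q_k x * q_i y)
     (q_re x * q_k y + q_i x * q_j y - q_j x * q_i y + q_k x * q_re y)"

instance
  by standard (simp_all add: quat_eq_iff one_quat_def times_quat_def algebra_simps)

end

instantiation quat :: real_inner
begin

definition inner_quat :: "quat \<Rightarrow> quat \<Rightarrow> real" where
  "inner x y = q_re x * q_re y + q_i x * q_i y + q_j x * q_j y + q_k x * q_k y"

definition norm_quat :: "quat \<Rightarrow> real" where
  "norm x = sqrt ((q_re x)\<^sup>2 + (q_i x)\<^sup>2 + (q_j x)\<^sup>2 + (q_k x)\<^sup>2)"

definition sgn_quat :: "quat \<Rightarrow> quat" where
  "sgn x = x /\<^sub>R norm x" for x :: quat

definition dist_quat :: "quat \<Rightarrow> quat \<Rightarrow> real" where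
  "dist x y = norm (x - y)" for x y :: quat

definition uniformity_quat :: "(quat \<times> quat) filter" where
  "uniformity = (INF e\<in>{0<..}. principal {(x :: quat, y). dist x y < e})"

definition open_quat :: "quat set \<Rightarrow> bool" where
  "open U \<longleftrightarrow> (\<forall>x\<in>U. eventually (\<lambda>(x', y). x' = x \<longrightarrow> y \<in> U) uniformity)" for U :: "quat set"

instance
proof
  fix x y z :: quat and r :: real
  show "inner x x = 0 \<longleftrightarrow> x = 0"
    by (simp add: inner_quat_def quat_eq_iff add_nonneg_eq_0_iff)
qed (simp_all add: inner_quat_def norm_quat_def sgn_quat_def dist_quat_def uniformity_quat_def
      open_quat_def power2_eq_square algebra_simps)

end

instantiation quat :: real_normed_div_algebra
begin

definition inverse_quat :: "quat \<Rightarrow> quat" where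
  "inverse x = Quat (q_re x) (- q_i x) (- q_j x) (- q_k x) /\<^sub>R (norm x)\<^sup>2"

definition divide_quat :: "quat \<Rightarrow> quat \<Rightarrow> quat" where
  "x div y = x * inverse y" for x y :: quat

instance
proof
  fix x y :: quat
  have norm_sq: "(norm x)\<^sup>2 = (q_re x)\<^sup>2 + (q_i x)\<^sup>2 + (q_j x)\<^sup>2 + (q_k x)\<^sup>2"
    by (simp add: norm_quat_def)
  show "x div y = x * inverse y"
    by (simp add: divide_quat_def)
  show "inverse (0::quat) = 0"
    by (simp add: inverse_quat_def quat_eq_iff)
  show "norm (x * y) = norm x * norm y"
    unfolding norm_quat_def real_sqrt_mult [symmetric]
    by (simp add: times_quat_def power2_eq_square algebra_simps)
  assume "x \<noteq> 0"
  then have nz: "(q_re x)\<^sup>2 + (q_i x)\<^sup>2 + (q_j x)\<^sup>2 + (q_k x)\<^sup>2 \<noteq> 0"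
    using norm_sq by (metis norm_eq_zero power_eq_0_iff)
  show "inverse x * x = 1" "x * inverse x = 1"
    using nz unfolding inverse_quat_def norm_sq
    by (simp_all add: quat_eq_iff times_quat_def one_quat_def divide_simps)
       (simp_all add: power2_eq_square algebra_simps)
qed

end

definition signQ :: "quat \<Rightarrow> quat" where
  "signQ q = (if norm q \<noteq> 0 then q / of_real (norm q) else 0)"

definition qgst_objective :: "quat \<Rightarrow> real \<Rightarrow> real \<Rightarrow> quat \<Rightarrow> real" where
  "qgst_objective y \<nu> p x = 1 / 2 * (norm (x - y))\<^sup>2 + \<nu> * norm x powr p"

definition qgst_threshold :: "real \<Rightarrow> real \<Rightarrow> real" where
  "qgst_threshold \<nu> p =
     (2 * \<nu> * (1 - p)) powr (1 / (2 - p)) +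
     \<nu> * p * (2 * \<nu> * (1 - p)) powr ((p - 1) / (2 - p))"

definition qgst_solution :: "real \<Rightarrow> real \<Rightarrow> real \<Rightarrow> real \<Rightarrow> bool" where
  "qgst_solution \<nu> p r t \<longleftrightarrow> 0 < t \<and> t - r + \<nu> * p * t powr (p - 1) = 0"

text \<open>
  Above the threshold the equation has two positive solutions. The smaller one is a local
  maximum of the radial objective, so the operator is built from the larger one.
\<close>

definition qgst_T :: "real \<Rightarrow> real \<Rightarrow> real \<Rightarrow> real" where
  "qgst_T \<nu> p r = (GREATEST t. qgst_solution \<nu> p r t)"

definition QGST :: "quat \<Rightarrow> real \<Rightarrow> real \<Rightarrow> quat" where
  "QGST y \<nu> p =
     (if norm y \<le> qgst_threshold \<nu> p then 0
      else signQ y * of_real (qgst_T \<nu> p (norm y)))"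

end

theory Submission
  imports Defs
begin

text \<open>
  Since \<open>\<bar>\<bar>x\<bar> - \<bar>y\<bar>\<bar> \<le> \<bar>x - y\<bar>\<close>, with equality when \<open>x\<close> is a nonnegative multiple of \<open>y\<close>,
  it suffices to minimize the radial objective \<open>h t = (t - r)\<^sup>2 / 2 + \<nu> t\<^sup>p\<close> over \<open>t \<ge> 0\<close>,
  where \<open>r = \<bar>y\<bar>\<close> (\<open>radial_le_qgst_objective\<close>, \<open>qgst_objective_along_signQ\<close>).
  The radial problem is governed by a single convexity estimate, the tangent
  inequality \<open>1 - (1 - p) (u - 1) \<le> u\<^sup>p\<^sup>-\<^sup>1\<close> for \<open>u > 0\<close> (\<open>powr_tangent_at_1\<close>), used three times.
  Let \<open>a\<close> be the knee, the positive number with \<open>a\<^sup>2\<^sup>-\<^sup>p = 2 \<nu> (1 - p)\<close>.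

  For \<open>t > 0\<close> one has \<open>h t - h 0 = t (t / 2 + \<nu> t\<^sup>p\<^sup>-\<^sup>1 - r)\<close>. The convex function
  \<open>t / 2 + \<nu> t\<^sup>p\<^sup>-\<^sup>1\<close> is smallest at \<open>a\<close>, with value equal to the threshold
  (\<open>qgst_threshold_le\<close>); hence \<open>0\<close> is optimal when \<open>r\<close> does not exceed the threshold.

  The stationarity equation reads \<open>F t = r\<close> with \<open>F t = t + \<nu> p t\<^sup>p\<^sup>-\<^sup>1\<close>, and the threshold is
  also \<open>F a\<close>. If \<open>F a < r\<close>, the intermediate value theorem gives a solution \<open>T > a\<close>; as \<open>F\<close>
  is convex and \<open>F a < F T\<close>, it exceeds \<open>r\<close> to the right of \<open>T\<close>, so \<open>T\<close> is the greatest
  solution. Finally \<open>T \<ge> a\<close> means \<open>2 \<nu> (1 - p) T\<^sup>p \<le> T\<^sup>2\<close>, that is, the quadratic term of \<open>h\<close>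
  is strong enough to outweigh the concavity of \<open>\<nu> t\<^sup>p\<close>. With \<open>u = t / T\<close>, the claim
  \<open>h T \<le> h t\<close> then reduces to the tangent inequality at \<open>u\<close>, multiplied by \<open>u\<close>
  (\<open>stationary_beyond_knee_minimal\<close>).
\<close>

definition radial :: "real \<Rightarrow> real \<Rightarrow> real \<Rightarrow> real \<Rightarrow> real" where
  "radial \<nu> p r t = 1 / 2 * (t - r)\<^sup>2 + \<nu> * t powr p"

definition knee :: "real \<Rightarrow> real \<Rightarrow> real" where
  "knee \<nu> p = (2 * \<nu> * (1 - p)) powr (1 / (2 - p))"


section \<open>The tangent inequality for negative powers\<close>

text \<open>
  Both steps are the tangent bound for the exponential: \<open>u\<^sup>p\<^sup>-\<^sup>1 = exp ((p - 1) ln u)\<close> is at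
  least \<open>1 + (p - 1) ln u\<close>, and \<open>ln u \<le> u - 1\<close> enters with the nonpositive factor \<open>p - 1\<close>.
\<close>

lemma powr_tangent_at_1:
  fixes u p :: real
  assumes "0 < u" "p \<le> 1"
  shows "1 - (1 - p) * (u - 1) \<le> u powr (p - 1)"
proof -
  have "(1 - p) * ln u \<le> (1 - p) * (u - 1)"
    using assms by (intro mult_left_mono ln_le_minus_one) auto
  then have "1 - (1 - p) * (u - 1) \<le> 1 + (p - 1) * ln u"
    by (simp add: algebra_simps)
  also have "\<dots> \<le> exp ((p - 1) * ln u)"
    by (rule exp_ge_add_one_self)
  finally show ?thesis
    using assms by (simp add: powr_def)
qed

lemma powr_tangent:
  fixes s t p :: real
  assumes "0 < s" "0 < t" "p \<le> 1"
  shows "s powr (p - 1) * (1 - (1 - p) * (t / s - 1)) \<le> t powr (p - 1)"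
proof -
  have "s powr (p - 1) * (1 - (1 - p) * (t / s - 1)) \<le> s powr (p - 1) * (t / s) powr (p - 1)"
    using assms by (intro mult_left_mono powr_tangent_at_1) auto
  also have "\<dots> = t powr (p - 1)"
    using assms by (simp add: powr_divide)
  finally show ?thesis .
qed


section \<open>The threshold\<close>

lemma knee_pos: "0 < \<nu> \<Longrightarrow> p < 1 \<Longrightarrow> 0 < knee \<nu> p"
  by (simp add: knee_def)

lemma knee_powr:
  assumes "0 < \<nu>" "p < 1"
  shows "knee \<nu> p powr (2 - p) = 2 * \<nu> * (1 - p)"
  using assms by (simp add: knee_def powr_powr)

text \<open>The form in which the defining equation of the knee enters all later computations.\<close>

lemma knee_stationary:
  assumes "0 < \<nu>" "p < 1"
  shows "2 * (1 - p) * (\<nu> * knee \<nu> p powr (p - 1)) = knee \<nu> p"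
proof -
  have "2 * (1 - p) * (\<nu> * knee \<nu> p powr (p - 1)) = knee \<nu> p powr (2 - p) * knee \<nu> p powr (p - 1)"
    using knee_powr [OF assms] by (simp add: mult_ac)
  also have "\<dots> = knee \<nu> p powr 1"
    by (simp flip: powr_add)
  finally show ?thesis
    using knee_pos [OF assms] by simp
qed

lemma qgst_threshold_knee:
  "qgst_threshold \<nu> p = knee \<nu> p + \<nu> * p * knee \<nu> p powr (p - 1)"
  by (simp add: qgst_threshold_def knee_def powr_powr)

lemma qgst_threshold_pos:
  assumes "0 < \<nu>" "0 < p" "p < 1"
  shows "0 < qgst_threshold \<nu> p"
  using assms knee_pos [of \<nu> p] by (simp add: qgst_threshold_knee add_pos_nonneg)

text \<open>
  The threshold is the minimum over \<open>t > 0\<close> of \<open>t / 2 + \<nu> t\<^sup>p\<^sup>-\<^sup>1\<close>, attained at the knee. The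
  tangent at the knee gives the bound because its slope there cancels that of \<open>t / 2\<close>.
\<close>

lemma qgst_threshold_le:
  assumes "0 < \<nu>" "p < 1" "0 < t"
  shows "qgst_threshold \<nu> p \<le> t / 2 + \<nu> * t powr (p - 1)"
proof -
  define a where "a = knee \<nu> p"
  define c where "c = \<nu> * a powr (p - 1)"
  have a: "0 < a" and c: "2 * (1 - p) * c = a"
    using assms knee_pos knee_stationary by (auto simp: a_def c_def)
  have "\<nu> * (a powr (p - 1) * (1 - (1 - p) * (t / a - 1))) \<le> \<nu> * t powr (p - 1)"
    using assms a by (intro mult_left_mono powr_tangent) auto
  moreover have "\<nu> * (a powr (p - 1) * (1 - (1 - p) * (t / a - 1)))
      = c - ((1 - p) * c) * (t / a - 1)"
    by (simp add: c_def algebra_simps add_divide_distrib diff_divide_distrib)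
  moreover have "(1 - p) * c = a / 2"
    using c by (simp add: algebra_simps)
  moreover have "a / 2 * (t / a - 1) = t / 2 - a / 2"
    using a by (simp add: field_simps)
  moreover have "qgst_threshold \<nu> p = a + p * c"
    by (simp add: qgst_threshold_knee a_def c_def)
  moreover have "a + p * c = c + a / 2"
    using c by (simp add: algebra_simps)
  ultimately show ?thesis
    by (simp add: diff_divide_distrib)
qed


section \<open>The radial minimization problem\<close>

lemma radial_minimal_at_0:
  assumes "0 < \<nu>" "p < 1" "r \<le> qgst_threshold \<nu> p" "0 \<le> t"
  shows "radial \<nu> p r 0 \<le> radial \<nu> p r t"
proof (cases "t = 0")
  case False
  with assms have t: "0 < t" by simp
  have "0 \<le> t * (t / 2 + \<nu> * t powr (p - 1) - r)"
    using assms t qgst_threshold_le [of \<nu> p t] by (intro mult_nonneg_nonneg) auto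
  also have "\<dots> = radial \<nu> p r t - radial \<nu> p r 0"
    using t by (simp add: radial_def powr_diff power2_eq_square field_simps)
  finally show ?thesis by simp
qed simp

lemma ex_qgst_solution_beyond_knee:
  assumes "0 < \<nu>" "0 < p" "p < 1" "qgst_threshold \<nu> p < r"
  shows "\<exists>T > knee \<nu> p. qgst_solution \<nu> p r T"
proof -
  define F where "F t = t + \<nu> * p * t powr (p - 1)" for t
  have a: "0 < knee \<nu> p"
    using assms by (simp add: knee_pos)
  have Fa: "F (knee \<nu> p) < r"
    using assms by (simp add: F_def qgst_threshold_knee)
  moreover have "r \<le> F r"
    using assms by (simp add: F_def)
  moreover have "knee \<nu> p \<le> r"
  proof -
    have "knee \<nu> p \<le> F (knee \<nu> p)"
      using assms by (simp add: F_def)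
    with Fa show ?thesis by simp
  qed
  moreover have "continuous_on {knee \<nu> p..r} F"
    unfolding F_def using a by (intro continuous_intros) auto
  ultimately obtain T where T: "knee \<nu> p \<le> T" "F T = r"
    using IVT' [of F "knee \<nu> p" r r] by auto
  with Fa have "knee \<nu> p < T"
    by (cases "knee \<nu> p = T") auto
  with T a show ?thesis
    by (intro exI [of _ T]) (auto simp: qgst_solution_def F_def)
qed

text \<open>
  The left-hand side \<open>F\<close> of the equation \<open>t + \<nu> p t\<^sup>p\<^sup>-\<^sup>1 = r\<close> lies above its tangent at \<open>T\<close>.
  Evaluating the tangent at the knee, where \<open>F\<close> is below \<open>r\<close>, shows that its slope is positive;
  evaluating it at any \<open>t > T\<close> then shows \<open>F t > r\<close>.
\<close>

lemma qgst_solution_beyond_knee_greatest: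
  assumes "0 < \<nu>" "0 < p" "p < 1" "qgst_threshold \<nu> p < r"
    and T: "qgst_solution \<nu> p r T" "knee \<nu> p < T"
    and t: "qgst_solution \<nu> p r t"
  shows "t \<le> T"
proof (rule ccontr)
  assume "\<not> t \<le> T"
  define m where "m = 1 - \<nu> * p * T powr (p - 1) * (1 - p) / T"
  have T0: "0 < T" and Tr: "r = T + \<nu> * p * T powr (p - 1)"
    using T(1) by (auto simp: qgst_solution_def)
  have tangent: "r + m * (s - T) \<le> s + \<nu> * p * s powr (p - 1)" if "0 < s" for s
  proof -
    have "\<nu> * p * (T powr (p - 1) * (1 - (1 - p) * (s / T - 1))) \<le> \<nu> * p * s powr (p - 1)"
      using assms T0 that by (intro mult_left_mono powr_tangent) auto
    moreover have "r + m * (s - T) = s + \<nu> * p * (T powr (p - 1) * (1 - (1 - p) * (s / T - 1)))"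
      using T0 by (simp add: m_def Tr field_simps)
    ultimately show ?thesis by simp
  qed
  have "r + m * (knee \<nu> p - T) < r"
    using tangent [of "knee \<nu> p"] assms knee_pos [of \<nu> p] by (simp add: qgst_threshold_knee)
  then have "0 < m"
    using T(2) by (simp add: mult_less_0_iff)
  then have "0 < m * (t - T)"
    using \<open>\<not> t \<le> T\<close> by simp
  with tangent [of t] t show False
    by (auto simp: qgst_solution_def)
qed

lemma qgst_T_eqI:
  assumes "0 < \<nu>" "0 < p" "p < 1" "qgst_threshold \<nu> p < r"
    and "qgst_solution \<nu> p r T" "knee \<nu> p < T"
  shows "qgst_T \<nu> p r = T"
  unfolding qgst_T_def using assms
  by (intro Greatest_equality) (auto intro: qgst_solution_beyond_knee_greatest)

text \<open>
  The equation for \<open>T\<close> eliminates \<open>r\<close>: with \<open>u = t / T\<close> and \<open>b = \<nu> T\<^sup>p\<close>, the difference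
  \<open>h t - h T\<close> equals \<open>T\<^sup>2 / 2 (u - 1)\<^sup>2 + b (u\<^sup>p - 1 - p (u - 1))\<close>. As \<open>T\<^sup>2 \<ge> 2 (1 - p) b\<close>, this
  is at least \<open>b\<close> times \<open>u (u\<^sup>p\<^sup>-\<^sup>1 - 1 + (1 - p) (u - 1))\<close>.
\<close>

lemma stationary_beyond_knee_minimal:
  assumes "0 < \<nu>" "p < 1"
    and T: "qgst_solution \<nu> p r T" "knee \<nu> p \<le> T" and "0 \<le> t"
  shows "radial \<nu> p r T \<le> radial \<nu> p r t"
proof -
  define u where "u = t / T"
  define b where "b = \<nu> * T powr p"
  have T0: "0 < T" and Tr: "r = T + \<nu> * p * T powr (p - 1)"
    using T(1) by (auto simp: qgst_solution_def)
  have u: "0 \<le> u" and t: "t = T * u"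
    using assms(5) T0 by (auto simp: u_def)
  have b: "0 < b"
    using assms T0 by (simp add: b_def)
  have rT: "T * r = T\<^sup>2 + p * b"
    using T0 by (simp add: Tr b_def powr_diff power2_eq_square field_simps)
  have bT: "2 * (1 - p) * b \<le> T\<^sup>2"
  proof -
    have "2 * \<nu> * (1 - p) \<le> T powr (2 - p)"
      using knee_powr [of \<nu> p] powr_mono2 [of "2 - p" "knee \<nu> p" T] knee_pos [of \<nu> p] assms
      by simp
    then have "2 * \<nu> * (1 - p) * T powr p \<le> T powr (2 - p) * T powr p"
      by (intro mult_right_mono) auto
    also have "\<dots> = T\<^sup>2"
      using T0 by (simp flip: powr_add)
    finally show ?thesis
      by (simp add: b_def mult_ac)
  qed
  have key: "0 \<le> (1 - p) * (u - 1)\<^sup>2 + u powr p - 1 - p * (u - 1)"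
  proof (cases "u = 0")
    case False
    with u have u: "0 < u" by simp
    have "0 \<le> u * (u powr (p - 1) - (1 - (1 - p) * (u - 1)))"
      using u assms powr_tangent_at_1 [of u p] by (intro mult_nonneg_nonneg) auto
    also have "\<dots> = (1 - p) * (u - 1)\<^sup>2 + u powr p - 1 - p * (u - 1)"
      using u by (simp add: powr_diff power2_eq_square field_simps)
    finally show ?thesis .
  qed simp
  have "0 \<le> b * ((1 - p) * (u - 1)\<^sup>2 + u powr p - 1 - p * (u - 1))"
    using b key by simp
  also have "\<dots> = 2 * (1 - p) * b * ((u - 1)\<^sup>2 / 2) + b * (u powr p - 1 - p * (u - 1))"
    by (simp add: field_simps)
  also have "\<dots> \<le> T\<^sup>2 * ((u - 1)\<^sup>2 / 2) + b * (u powr p - 1 - p * (u - 1))"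
    by (intro add_right_mono mult_right_mono bT) auto
  also have "\<dots> = (T\<^sup>2 * u\<^sup>2 - T\<^sup>2) / 2 - (T\<^sup>2 + p * b) * (u - 1) + b * (u powr p - 1)"
    by (simp add: power2_eq_square field_simps)
  also have "\<dots> = (T\<^sup>2 * u\<^sup>2 - T\<^sup>2) / 2 - T * r * (u - 1) + b * (u powr p - 1)"
    by (simp add: rT)
  also have "\<dots> = radial \<nu> p r t - radial \<nu> p r T"
    using u T0 by (simp add: radial_def t b_def powr_mult power2_eq_square field_simps)
  finally show ?thesis
    by simp
qed


section \<open>Reduction of the quaternion problem to the radial problem\<close>

lemma radial_le_qgst_objective:
  "radial \<nu> p (norm y) (norm x) \<le> qgst_objective y \<nu> p x"
proof -
  have "\<bar>norm x - norm y\<bar>\<^sup>2 \<le> (norm (x - y))\<^sup>2"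
    by (intro power_mono norm_triangle_ineq3) auto
  then show ?thesis
    by (simp add: radial_def qgst_objective_def)
qed

lemma mult_of_real_eq_scaleR:
  fixes x :: "'a :: real_algebra_1"
  shows "x * of_real c = c *\<^sub>R x"
  by (simp add: of_real_def)

lemma signQ_eq_sgn: "signQ y = sgn y"
  by (simp add: signQ_def sgn_quat_def divide_inverse mult_of_real_eq_scaleR flip: of_real_inverse)

lemma qgst_objective_along_signQ:
  assumes "y \<noteq> 0" "0 \<le> t"
  shows "qgst_objective y \<nu> p (signQ y * of_real t) = radial \<nu> p (norm y) t"
proof -
  have "norm y *\<^sub>R sgn y = y"
    using assms by (simp add: sgn_div_norm)
  then have "signQ y * of_real t - y = (t - norm y) *\<^sub>R sgn y"
    by (simp add: signQ_eq_sgn mult_of_real_eq_scaleR scaleR_left_diff_distrib)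
  then have "norm (signQ y * of_real t - y) = \<bar>t - norm y\<bar>"
    using assms by (simp add: norm_sgn)
  moreover have "norm (signQ y * of_real t) = t"
    using assms by (simp add: signQ_eq_sgn norm_mult norm_sgn)
  ultimately show ?thesis
    by (simp add: qgst_objective_def radial_def)
qed

theorem theorem1:
  fixes y :: quat and \<nu> p :: real
  assumes "0 < \<nu>" and "0 < p" and "p < 1"
  shows "(norm y > qgst_threshold \<nu> p \<longrightarrow>
            qgst_solution \<nu> p (norm y) (qgst_T \<nu> p (norm y)) \<and>
            (\<forall>t. qgst_solution \<nu> p (norm y) t \<longrightarrow> t \<le> qgst_T \<nu> p (norm y))) \<and>
         (\<forall>x. qgst_objective y \<nu> p (QGST y \<nu> p) \<le> qgst_objective y \<nu> p x)"
proof (cases "norm y \<le> qgst_threshold \<nu> p")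
  case True
  then have "qgst_objective y \<nu> p (QGST y \<nu> p) = radial \<nu> p (norm y) 0"
    by (simp add: QGST_def qgst_objective_def radial_def)
  with True assms have "qgst_objective y \<nu> p (QGST y \<nu> p) \<le> qgst_objective y \<nu> p x" for x
    using radial_minimal_at_0 [of \<nu> p "norm y" "norm x"] radial_le_qgst_objective [of \<nu> p y x]
    by simp
  with True show ?thesis by simp
next
  case False
  then have r: "qgst_threshold \<nu> p < norm y" by simp
  obtain T where T: "knee \<nu> p < T" "qgst_solution \<nu> p (norm y) T"
    using ex_qgst_solution_beyond_knee [OF assms r] by blast
  have qgst_T: "qgst_T \<nu> p (norm y) = T"
    using qgst_T_eqI [OF assms r] T by simp
  have "y \<noteq> 0"
    using r qgst_threshold_pos [OF assms] by auto
  moreover have "0 \<le> T"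
    using T by (simp add: qgst_solution_def)
  ultimately have "qgst_objective y \<nu> p (QGST y \<nu> p) = radial \<nu> p (norm y) T"
    using False by (simp add: QGST_def qgst_T qgst_objective_along_signQ)
  then have "qgst_objective y \<nu> p (QGST y \<nu> p) \<le> qgst_objective y \<nu> p x" for x
    using stationary_beyond_knee_minimal [of \<nu> p "norm y" T "norm x"] assms T
      radial_le_qgst_objective [of \<nu> p y x]
    by simp
  with T show ?thesis
    using qgst_solution_beyond_knee_greatest [OF assms r] by (auto simp: qgst_T)
qed

end
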